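(* Let $n = 4k$ for a positive integer $k$. Then there exists a feasible single round robin schedule for the $n$ teams $1,\dots,n$ that is single-break (hence minimum-break) and ranking-fair.
   Context: Teams are $T=\{1,\dots,n\}$ ($n$ even), ranked by strength: team $i$ is stronger than team $j$ iff $i<j$. Rounds are $R=\{1,\dots,n-1\}$. A schedule assigns to each unordered pair $\{i,j\}$ of distinct teams a round in $R$ in which they play, and designates which of the two plays at home (the other plays away). A schedule is feasible if every team plays exactly one game in every round. The ranking HAP of team $i$ is the vector $(p_1,\dots,p_{n-1})$ with $p_m\in\{H,A\}$ indicating whether team $i$ plays home or away against its $m$-th strongest opponent (opponents listed in increasing order of index). A schedule is ranking-fair if the ranking HAP of every team alternates between $H$ and $A$ (no two consecutive entries equal). The home-away pattern (HAP) of a team is $(h_1,\dots,h_{n-1})$ with $h_r\in\{H,A\}$ its venue in round $r$; HAPs are read cyclically, with $h_0:=h_{n-1}$, and a team has a break in round $r$ if $h_{r-1}=h_r$. Since $n-1$ is odd, every HAP has at least one break; a schedule is single-break if every team's HAP has exactly one break, which minimizes the number of breaks. *)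

theory Defs
  imports Main
begin

datatype venue = Home | Away

definition teams :: "nat \<Rightarrow> nat set" where
  "teams n = {1..n}"

definition rounds :: "nat \<Rightarrow> nat set" where
  "rounds n = {1..n - 1}"

text \<open>Teams are named by their rank, 1 being the strongest.  Both components of a schedule
  take an unordered pair of teams as argument; their values on other sets are irrelevant.\<close>

record schedule =
  round_of :: "nat set \<Rightarrow> nat"
  home_team :: "nat set \<Rightarrow> nat"

definition is_schedule :: "nat \<Rightarrow> schedule \<Rightarrow> bool" where
  "is_schedule n S \<longleftrightarrow>
     (\<forall>i\<in>teams n. \<forall>j\<in>teams n. i \<noteq> j \<longrightarrow>
        round_of S {i, j} \<in> rounds n \<and> home_team S {i, j} \<in> {i, j})"

definition plays_in :: "nat \<Rightarrow> schedule \<Rightarrow> nat \<Rightarrow> nat \<Rightarrow> nat \<Rightarrow> bool" where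
  "plays_in n S i r j \<longleftrightarrow> j \<in> teams n \<and> j \<noteq> i \<and> round_of S {i, j} = r"

definition feasible :: "nat \<Rightarrow> schedule \<Rightarrow> bool" where
  "feasible n S \<longleftrightarrow>
     is_schedule n S \<and> (\<forall>i\<in>teams n. \<forall>r\<in>rounds n. \<exists>!j. plays_in n S i r j)"

definition venue_against :: "schedule \<Rightarrow> nat \<Rightarrow> nat \<Rightarrow> venue" where
  "venue_against S i j = (if home_team S {i, j} = i then Home else Away)"

definition ranking_hap :: "nat \<Rightarrow> schedule \<Rightarrow> nat \<Rightarrow> venue list" where
  "ranking_hap n S i = map (venue_against S i) (sorted_list_of_set (teams n - {i}))"

definition ranking_fair :: "nat \<Rightarrow> schedule \<Rightarrow> bool" where
  "ranking_fair n S \<longleftrightarrow> (\<forall>i\<in>teams n. successively (\<noteq>) (ranking_hap n S i))"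

text \<open>Meaningful only for feasible schedules, where the opponent is unique.\<close>

definition opponent :: "nat \<Rightarrow> schedule \<Rightarrow> nat \<Rightarrow> nat \<Rightarrow> nat" where
  "opponent n S i r = (THE j. plays_in n S i r j)"

text \<open>Patterns are read cyclically: index 0 stands for the last round.\<close>

definition hap :: "nat \<Rightarrow> schedule \<Rightarrow> nat \<Rightarrow> nat \<Rightarrow> venue" where
  "hap n S i r = venue_against S i (opponent n S i (if r = 0 then n - 1 else r))"

definition breaks :: "nat \<Rightarrow> schedule \<Rightarrow> nat \<Rightarrow> nat set" where
  "breaks n S i = {r \<in> rounds n. hap n S i (r - 1) = hap n S i r}"

definition single_break :: "nat \<Rightarrow> schedule \<Rightarrow> bool" where
  "single_break n S \<longleftrightarrow> (\<forall>i\<in>teams n. card (breaks n S i) = 1)"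

definition total_breaks :: "nat \<Rightarrow> schedule \<Rightarrow> nat" where
  "total_breaks n S = (\<Sum>i\<in>teams n. card (breaks n S i))"

definition minimum_break :: "nat \<Rightarrow> schedule \<Rightarrow> bool" where
  "minimum_break n S \<longleftrightarrow> (\<forall>S'. feasible n S' \<longrightarrow> total_breaks n S \<le> total_breaks n S')"

end

theory Submission
  imports Defs
begin

text \<open>Ranking-fairness forces the venues up to a global swap: the stronger of two teams plays at
  home iff their ranks have different parity.  Number the \<open>4 k - 1\<close> rounds cyclically by slots, in
  the order in which every second round is visited.  Then a pattern has a single break, say at
  slot \<open>u\<close>, iff the team is at home exactly in the \<open>2 k\<close> consecutive slots starting at \<open>u\<close>
  (or away exactly in these).  The rank reversal \<open>x \<mapsto> 4 k + 1 - x\<close> swaps home and away; asking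
  the schedule to be invariant under it, with slots fixed, leaves two levels of \<open>k\<close> indices each.
  Among the teams of odd rank, low \<open>i\<close> is at home exactly in the slots
  \<open>2 i, \<dots>, 2 i + 2 k - 1\<close> and high \<open>i\<close> is away exactly in \<open>2 i + 1, \<dots>, 2 i + 2 k - 1\<close>; the
  reversal gives the teams of even rank the complementary patterns.
  It remains to place the games by a Latin-square-like rule compatible with these arcs.\<close>

definition low :: "nat \<Rightarrow> nat \<Rightarrow> bool" where
  "low k x \<longleftrightarrow> (if odd x then 2 * k < x else x \<le> 2 * k)"

definition idx :: "nat \<Rightarrow> nat \<Rightarrow> nat" where
  "idx k x = (if odd x then (if low k x then 2 * k - 1 - x div 2 else x div 2)
              else (if low k x then x div 2 - 1 else 2 * k - x div 2))"

text \<open>The sum rule \<open>i + j\<close>, with period \<open>4 k\<close> for the four kinds of games, is one slot too long.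
  For games between the levels the slots \<open>k + a + b\<close> and \<open>2 k + a + b\<close> are therefore compressed:
  the second family loses one slot above the diagonal, and the last low index \<open>k - 1\<close> absorbs the
  resulting gaps \<open>2 k + 2 b - 1\<close> and \<open>2 k + 2 b\<close> of each high index \<open>b\<close>.  Each low or high index
  \<open>i\<close> then uses \<open>i, \<dots>, i + k - 1\<close> for opponents of its own level and parity (the hole \<open>2 i\<close>
  being filled by the game between low \<open>i\<close> and high \<open>i\<close> of the other parity), \<open>k + i, \<dots>, 3 k - 2 + i\<close> between the levels,
  and the remaining \<open>k\<close> slots for its own level and the other parity.\<close>

definition pair_slot :: "nat \<Rightarrow> bool \<Rightarrow> nat \<Rightarrow> bool \<Rightarrow> bool \<Rightarrow> nat \<Rightarrow> nat" where
  "pair_slot k l i same l' j =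
     (if l = l' then
        (if same then i + j
         else if i + j < k then 3 * k - 1 + (i + j) else i + j - k)
      else
        (let a = (if l then i else j); b = (if l then j else i) in
         if same then (if a < k - 1 then k + a + b else 2 * k + 2 * b - 1)
         else if a = b then 2 * a
         else if a < b then 2 * k + a + b - 1
         else if a < k - 1 then 2 * k + a + b
         else 2 * k + 2 * b))"

definition slot :: "nat \<Rightarrow> nat \<Rightarrow> nat \<Rightarrow> nat" where
  "slot k x y = pair_slot k (low k x) (idx k x) (odd x = odd y) (low k y) (idx k y)"

definition home_slot :: "nat \<Rightarrow> nat \<Rightarrow> nat \<Rightarrow> bool" where
  "home_slot k x t \<longleftrightarrow>
     (odd x = (if low k x then 2 * idx k x \<le> t \<and> t < 2 * idx k x + 2 * k
               else t \<le> 2 * idx k x \<or> 2 * idx k x + 2 * k \<le> t))"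

text \<open>Away from a break, venues two rounds apart agree; so visiting the odd rounds before the
  even ones turns alternation into arcs.\<close>

definition slot_round :: "nat \<Rightarrow> nat \<Rightarrow> nat" where
  "slot_round k t = (if t < 2 * k then 2 * t + 1 else 2 * (t - 2 * k) + 2)"

definition round_slot :: "nat \<Rightarrow> nat \<Rightarrow> nat" where
  "round_slot k r = (if odd r then r div 2 else 2 * k + r div 2 - 1)"

definition fair_schedule :: "nat \<Rightarrow> schedule" where
  "fair_schedule k =
     \<lparr>round_of = (\<lambda>e. slot_round k (slot k (Min e) (Max e))),
      home_team = (\<lambda>e. if odd (Min e + Max e) then Min e else Max e)\<rparr>"

section \<open>Distinct opponents, distinct slots\<close>

lemma idx_less: "x \<in> teams (4 * k) \<Longrightarrow> idx k x < k"
  unfolding teams_def idx_def low_def by (auto elim!: oddE evenE)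

lemma team_eqI:
  assumes "x \<in> teams (4 * k)" "y \<in> teams (4 * k)"
    and "odd x = odd y" "low k x = low k y" "idx k x = idx k y"
  shows "x = y"
  using assms unfolding teams_def idx_def low_def
  by (auto elim!: oddE evenE split: if_splits)

lemma pair_slot_less:
  assumes "i < k" "j < k"
  shows "pair_slot k l i same l' j < 4 * k - 1"
  using assms unfolding pair_slot_def Let_def by (cases l; cases l'; cases same) auto

lemma pair_slot_inj:
  assumes "i < k" "j < k" "j' < k"
    and "\<not> (same \<and> l = m \<and> i = j)" "\<not> (same' \<and> l = m' \<and> i = j')"
    and "pair_slot k l i same m j = pair_slot k l i same' m' j'"
  shows "same = same' \<and> m = m' \<and> j = j'"
proof -
  \<comment> \<open>This clears the truncated \<open>k - 1\<close> from the arithmetic.\<close>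
  obtain K where "k = Suc K"
    using assms(1) by (cases k) auto
  with assms show ?thesis
    unfolding pair_slot_def Let_def
    by (cases l; cases m; cases m'; cases same; cases same') (auto split: if_splits, presburger+)
qed

lemma slot_commute: "slot k x y = slot k y x"
  unfolding slot_def pair_slot_def Let_def by (auto simp: add.commute add.left_commute)

lemma slot_less:
  "x \<in> teams (4 * k) \<Longrightarrow> y \<in> teams (4 * k) \<Longrightarrow> slot k x y < 4 * k - 1"
  unfolding slot_def by (intro pair_slot_less idx_less)

lemma inj_on_slot:
  assumes "x \<in> teams (4 * k)"
  shows "inj_on (slot k x) (teams (4 * k) - {x})"
proof (rule inj_onI)
  fix y z
  assume y: "y \<in> teams (4 * k) - {x}" and z: "z \<in> teams (4 * k) - {x}"
    and eq: "slot k x y = slot k x z"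
  have "(odd x = odd y) = (odd x = odd z) \<and> low k y = low k z \<and> idx k y = idx k z"
  proof (rule pair_slot_inj)
    show "idx k x < k" "idx k y < k" "idx k z < k"
      using assms y z by (auto intro: idx_less)
    show "\<not> (odd x = odd y \<and> low k x = low k y \<and> idx k x = idx k y)"
      using team_eqI[OF assms, of y] y by blast
    show "\<not> (odd x = odd z \<and> low k x = low k z \<and> idx k x = idx k z)"
      using team_eqI[OF assms, of z] z by blast
    show "pair_slot k (low k x) (idx k x) (odd x = odd y) (low k y) (idx k y) =
        pair_slot k (low k x) (idx k x) (odd x = odd z) (low k z) (idx k z)"
      using eq unfolding slot_def .
  qed
  with y z show "y = z" by (intro team_eqI[of y k z]) auto
qed

text \<open>Inverting \<open>idx\<close> makes ranks linear in the index, so that venues can be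
  compared by linear arithmetic.\<close>

lemma team_cases:
  assumes "x \<in> teams (4 * k)"
  obtains (odd_low) i where "i < k" "x = 4 * k - 1 - 2 * i" "odd x" "low k x" "idx k x = i"
    | (odd_high) i where "i < k" "x = 2 * i + 1" "odd x" "\<not> low k x" "idx k x = i"
    | (even_low) i where "i < k" "x = 2 * i + 2" "even x" "low k x" "idx k x = i"
    | (even_high) i where "i < k" "x = 4 * k - 2 * i" "even x" "\<not> low k x" "idx k x = i"
proof -
  have "idx k x < k" using assms by (rule idx_less)
  moreover have "x = (if odd x then if low k x then 4 * k - 1 - 2 * idx k x else 2 * idx k x + 1
                      else if low k x then 2 * idx k x + 2 else 4 * k - 2 * idx k x)"
    using assms unfolding teams_def idx_def low_def by (auto elim!: oddE evenE)
  ultimately show thesis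
    using that by (cases "odd x"; cases "low k x") simp_all
qed

text \<open>Here single breaks and fairness meet. For instance, low teams of odd rank with indices
  \<open>i > j\<close> meet in slot \<open>i + j\<close>, which precedes the home arc of
  \<open>i\<close>, the stronger one, and lies in that of \<open>j\<close>.\<close>

lemma home_slot_slot:
  assumes "x \<in> teams (4 * k)" "y \<in> teams (4 * k)" "x < y"
  shows "home_slot k x (slot k x y) = odd (x + y) \<and> home_slot k y (slot k x y) = even (x + y)"
  using assms(1)
proof (cases rule: team_cases)
  case (odd_low i)
  from assms(2) show ?thesis
    by (cases rule: team_cases)
      (use odd_low assms(3) in \<open>simp add: home_slot_def slot_def pair_slot_def; linarith\<close>)+
next
  case (odd_high i)
  from assms(2) show ?thesis
    by (cases rule: team_cases)
      (use odd_high assms(3) in \<open>simp add: home_slot_def slot_def pair_slot_def; linarith\<close>)+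
next
  case (even_low i)
  from assms(2) show ?thesis
    by (cases rule: team_cases)
      (use even_low assms(3) in \<open>simp add: home_slot_def slot_def pair_slot_def; linarith\<close>)+
next
  case (even_high i)
  from assms(2) show ?thesis
    by (cases rule: team_cases)
      (use even_high assms(3) in \<open>simp add: home_slot_def slot_def pair_slot_def; linarith\<close>)+
qed

section \<open>From slots to rounds\<close>

lemma slot_round_in_rounds: "t < 4 * k - 1 \<Longrightarrow> slot_round k t \<in> rounds (4 * k)"
  unfolding slot_round_def rounds_def by auto

lemma round_slot_less: "r \<in> rounds (4 * k) \<Longrightarrow> round_slot k r < 4 * k - 1"
  unfolding round_slot_def rounds_def by (auto elim!: oddE evenE)

lemma round_slot_slot_round [simp]: "round_slot k (slot_round k t) = t"
  unfolding round_slot_def slot_round_def by auto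

lemma slot_round_round_slot:
  "r \<in> rounds (4 * k) \<Longrightarrow> slot_round k (round_slot k r) = r"
  unfolding round_slot_def slot_round_def rounds_def by (auto elim!: oddE evenE)

lemma round_of_fair_schedule:
  assumes "x \<noteq> y"
  shows "round_of (fair_schedule k) {x, y} = slot_round k (slot k x y)"
  using assms unfolding fair_schedule_def
  by (cases x y rule: linorder_cases) (auto simp: slot_commute)

lemma home_team_fair_schedule:
  assumes "x \<noteq> y"
  shows "home_team (fair_schedule k) {x, y} = (if odd (x + y) then min x y else max x y)"
  using assms unfolding fair_schedule_def by (cases x y rule: linorder_cases) auto

lemma venue_against_fair_schedule:
  assumes "x \<noteq> y"
  shows "venue_against (fair_schedule k) x y = (if (x < y) = odd (x + y) then Home else Away)"
  using assms unfolding venue_against_def home_team_fair_schedule[OF assms]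
  by (cases x y rule: linorder_cases) auto

lemma venue_against_eq_home_slot:
  assumes "x \<in> teams (4 * k)" "y \<in> teams (4 * k)" "x \<noteq> y"
  shows "venue_against (fair_schedule k) x y =
    (if home_slot k x (slot k x y) then Home else Away)"
proof (cases "x < y")
  case True
  then show ?thesis
    using home_slot_slot[OF assms(1,2)] venue_against_fair_schedule[OF assms(3)] by simp
next
  case False
  then show ?thesis
    using home_slot_slot[OF assms(2,1)] venue_against_fair_schedule[OF assms(3)] assms(3)
    by (simp add: slot_commute[of k x y] add.commute)
qed

lemma ex1_slot:
  assumes "x \<in> teams (4 * k)" "t < 4 * k - 1"
  shows "\<exists>!y. y \<in> teams (4 * k) - {x} \<and> slot k x y = t"
proof -
  \<comment> \<open>Opponents and slots are equally many, so injectivity suffices.\<close>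
  have "slot k x ` (teams (4 * k) - {x}) = {..<4 * k - 1}"
  proof (rule card_subset_eq)
    show "slot k x ` (teams (4 * k) - {x}) \<subseteq> {..<4 * k - 1}"
      using slot_less[OF assms(1)] by blast
    show "card (slot k x ` (teams (4 * k) - {x})) = card {..<4 * k - 1}"
      using assms(1) by (subst card_image[OF inj_on_slot]) (simp_all add: teams_def)
  qed simp
  with assms(2) obtain y where "y \<in> teams (4 * k) - {x}" "slot k x y = t"
    by (metis imageE lessThan_iff)
  with inj_on_slot[OF assms(1)] show ?thesis
    by (metis inj_onD)
qed

lemma plays_in_fair_schedule:
  assumes "r \<in> rounds (4 * k)"
  shows "plays_in (4 * k) (fair_schedule k) x r y \<longleftrightarrow>
    y \<in> teams (4 * k) - {x} \<and> slot k x y = round_slot k r"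
  using assms unfolding plays_in_def
  by (auto simp: round_of_fair_schedule slot_round_round_slot)

lemma ex1_plays_in:
  assumes "x \<in> teams (4 * k)" "r \<in> rounds (4 * k)"
  shows "\<exists>!y. plays_in (4 * k) (fair_schedule k) x r y"
  unfolding plays_in_fair_schedule[OF assms(2)]
  by (intro ex1_slot assms round_slot_less)

lemma feasible_fair_schedule: "feasible (4 * k) (fair_schedule k)"
  unfolding feasible_def is_schedule_def
proof (intro conjI ballI impI)
  fix x y assume "x \<in> teams (4 * k)" "y \<in> teams (4 * k)" "x \<noteq> y"
  then show "round_of (fair_schedule k) {x, y} \<in> rounds (4 * k)"
    and "home_team (fair_schedule k) {x, y} \<in> {x, y}"
    by (simp_all add: round_of_fair_schedule home_team_fair_schedule min_def max_def
        slot_round_in_rounds slot_less del: One_nat_def)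
qed (rule ex1_plays_in)

lemma hap_fair_schedule:
  assumes "x \<in> teams (4 * k)" "r \<in> rounds (4 * k)"
  shows "hap (4 * k) (fair_schedule k) x r =
    (if home_slot k x (round_slot k r) then Home else Away)"
proof -
  let ?y = "opponent (4 * k) (fair_schedule k) x r"
  have "plays_in (4 * k) (fair_schedule k) x r ?y"
    unfolding opponent_def by (rule theI'[OF ex1_plays_in[OF assms]])
  then have y: "?y \<in> teams (4 * k)" "?y \<noteq> x" "slot k x ?y = round_slot k r"
    using plays_in_fair_schedule[OF assms(2)] by auto
  have "r \<noteq> 0"
    using assms(2) by (auto simp: rounds_def)
  with y show ?thesis
    using venue_against_eq_home_slot[OF assms(1) y(1)] by (simp add: hap_def)
qed

text \<open>The preceding round lies \<open>2 k - 1\<close> slots ahead, cyclically.\<close>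

lemma hap_pred_fair_schedule:
  assumes "x \<in> teams (4 * k)" "t < 4 * k - 1"
  shows "hap (4 * k) (fair_schedule k) x (slot_round k t - 1) =
    (if home_slot k x (if t < 2 * k then t + 2 * k - 1 else t - 2 * k) then Home else Away)"
proof -
  let ?p = "if t < 2 * k then t + 2 * k - 1 else t - 2 * k"
  have "?p < 4 * k - 1"
    using assms(2) by auto
  then have "hap (4 * k) (fair_schedule k) x (slot_round k ?p) =
      (if home_slot k x ?p then Home else Away)"
    using hap_fair_schedule[OF assms(1) slot_round_in_rounds] by simp
  \<comment> \<open>Slot 0 is round 1, whose predecessor is index 0, read by \<open>hap\<close> as
    the last round.\<close>
  moreover have "slot_round k ?p = (if t = 0 then 4 * k - 1 else slot_round k t - 1)"
    using assms(2) unfolding slot_round_def by auto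
  moreover have "t = 0 \<Longrightarrow> slot_round k t - 1 = 0"
    using assms(2) by (auto simp: slot_round_def)
  ultimately show ?thesis
    using assms(2) by (cases "t = 0") (auto simp: hap_def)
qed

text \<open>A jump of \<open>2 * k - 1\<close> slots stays in the arc of length \<open>2 * k\<close>
  only from its first slot, and always leaves the complementary arc of length
  \<open>2 * k - 1\<close>.\<close>

lemma home_slot_break_iff:
  assumes "i < k" "idx k x = i" "t < 4 * k - 1"
  shows "home_slot k x (if t < 2 * k then t + 2 * k - 1 else t - 2 * k) = home_slot k x t \<longleftrightarrow>
    t = (if low k x then 2 * i else 2 * i + 2 * k)"
  using assms unfolding home_slot_def by (cases "odd x"; cases "low k x") auto

lemma card_breaks_fair_schedule:
  assumes "x \<in> teams (4 * k)"
  shows "card (breaks (4 * k) (fair_schedule k) x) = 1"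
proof -
  define u where "u = (if low k x then 2 * idx k x else 2 * idx k x + 2 * k)"
  have i: "idx k x < k"
    using assms by (rule idx_less)
  then have u: "u < 4 * k - 1"
    unfolding u_def by auto
  have iff: "hap (4 * k) (fair_schedule k) x (r - 1) = hap (4 * k) (fair_schedule k) x r \<longleftrightarrow>
      round_slot k r = u" if r: "r \<in> rounds (4 * k)" for r
    using hap_pred_fair_schedule[OF assms round_slot_less[OF r]] hap_fair_schedule[OF assms r]
      home_slot_break_iff[OF i refl round_slot_less[OF r]] slot_round_round_slot[OF r]
    by (auto simp: u_def split: if_splits)
  have "breaks (4 * k) (fair_schedule k) x = {slot_round k u}"
    unfolding breaks_def using iff slot_round_in_rounds[OF u] slot_round_round_slot by fastforce
  then show ?thesis
    by simp
qed

text \<open>Venues cannot alternate around a cycle of odd length.\<close>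

lemma breaks_nonempty:
  assumes "odd (n - 1)"
  shows "breaks n S i \<noteq> {}"
proof
  assume "breaks n S i = {}"
  then have alt: "hap n S i (r - 1) \<noteq> hap n S i r" if "r \<in> rounds n" for r
    using that unfolding breaks_def by blast
  have "hap n S i r = hap n S i 0 \<longleftrightarrow> even r" if "r \<le> n - 1" for r
    using that
  proof (induction r)
    case (Suc r)
    with alt[of "Suc r"] show ?case
      by (cases "hap n S i 0"; cases "hap n S i r"; cases "hap n S i (Suc r)")
        (auto simp: rounds_def)
  qed simp
  from this[of "n - 1"] assms show False
    by (auto simp: hap_def)
qed

lemma single_break_imp_minimum_break:
  assumes "odd (n - 1)" "single_break n S"
  shows "minimum_break n S"
proof -
  have "total_breaks n S \<le> total_breaks n S'" for S'
    unfolding total_breaks_def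
  proof (rule sum_mono)
    fix i assume "i \<in> teams n"
    then have "card (breaks n S i) = 1"
      using assms(2) by (simp add: single_break_def)
    also have "finite (breaks n S' i)"
      by (simp add: breaks_def rounds_def)
    then have "1 \<le> card (breaks n S' i)"
      using breaks_nonempty[OF assms(1)] by (simp add: Suc_le_eq card_gt_0_iff)
    finally show "card (breaks n S i) \<le> card (breaks n S' i)" .
  qed
  then show ?thesis
    by (simp add: minimum_break_def)
qed

lemma successively_map_upt:
  assumes "\<And>j. a \<le> j \<Longrightarrow> Suc j < b \<Longrightarrow> P (f j) (f (Suc j))"
  shows "successively P (map f [a..<b])"
  unfolding successively_conv_nth using assms by auto

lemma sorted_list_of_teams_minus:
  assumes "i \<in> teams n"
  shows "sorted_list_of_set (teams n - {i}) = [1..<i] @ [Suc i..<Suc n]"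
proof -
  have "set ([1..<i] @ [Suc i..<Suc n]) = teams n - {i}"
    using assms by (auto simp: teams_def)
  moreover have "sorted ([1..<i] @ [Suc i..<Suc n])" "distinct ([1..<i] @ [Suc i..<Suc n])"
    by (auto simp: sorted_append)
  ultimately show ?thesis
    by (metis sorted_list_of_set.idem_if_sorted_distinct)
qed

text \<open>Consecutive opponents on the same side of \<open>i\<close> differ in parity;
  \<open>i - 1\<close> and \<open>i + 1\<close> agree in parity, but the order relative to
  \<open>i\<close> flips.\<close>

lemma ranking_fair_fair_schedule: "ranking_fair n (fair_schedule k)"
  unfolding ranking_fair_def
proof
  fix i assume "i \<in> teams n"
  then show "successively (\<noteq>) (ranking_hap n (fair_schedule k) i)"
    unfolding ranking_hap_def sorted_list_of_teams_minus[OF \<open>i \<in> teams n\<close>] map_append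
      successively_append_iff
    by (auto intro!: successively_map_upt simp: venue_against_fair_schedule
        last_map hd_map simp del: upt_Suc split: if_splits)
qed

theorem theorem1:
  fixes n k :: nat
  assumes "k > 0" and "n = 4 * k"
  shows "\<exists>S. feasible n S \<and> single_break n S \<and> minimum_break n S \<and> ranking_fair n S"
proof (intro exI conjI)
  show single: "single_break n (fair_schedule k)"
    using assms(2) card_breaks_fair_schedule by (simp add: single_break_def)
  show "feasible n (fair_schedule k)"
    using assms(2) feasible_fair_schedule by simp
  have "odd (n - 1)"
    using assms by simp
  then show "minimum_break n (fair_schedule k)"
    using single by (rule single_break_imp_minimum_break)
  show "ranking_fair n (fair_schedule k)"
    by (rule ranking_fair_fair_schedule)
qed

end
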